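(* Let $q=p^m$ be a power of a prime $p$, let $n\ge1$ and $c\ge0$ be integers, and for $i\in[n]$ let $\Gamma_i:\mathcal M(Q_{[n]}\cup B_{[c]})\to\mathcal M(Q_{[n]}\cup B_{[c]})$ be the map $\Gamma_i(\rho)=\frac{I_{Q_i}}{q}\otimes{\rm Tr}_{Q_i}(\rho)$. Then for every $i\in[n]$ and every $\rho\in\mathcal M(Q_{[n]}\cup B_{[c]})$, $$\Gamma_i(\rho)=\frac1{q^2}\sum_{a,b\in\mathbb F_q}\bigl(X_i(a)Z_i(b)\bigr)\,\rho\,\bigl(X_i(a)Z_i(b)\bigr)^\dagger.$$ Consequently, $\Gamma_i$ is a quantum channel.
   Context: $[n]=\{1,\dots,n\}$. A qudit has Hilbert space $\mathbb C^q$ with orthonormal basis $\{|x\rangle:x\in\mathbb F_q\}$. $Q_{[n]}=(Q_1,\dots,Q_n)$ and $B_{[c]}=(B_1,\dots,B_c)$ are registers of $n$ and $c$ qudits; $\mathcal H_A$ is the tensor product of the qudit spaces in register $A$ ($\mathbb C$ if $A$ is empty). $\mathcal M(A)$ is the set of density operators on $\mathcal H_A$ (positive semidefinite, trace $1$); ${\rm Tr}_{Q_i}$ is the partial trace over $Q_i$; in $\frac{I_{Q_i}}{q}\otimes{\rm Tr}_{Q_i}(\rho)$ the first factor sits at position $Q_i$ and all other labelled subsystems are unchanged. With ${\rm tr}:\mathbb F_q\to\mathbb F_p$ the field trace and $\omega_p=e^{2\pi i/p}$, $X(a)|x\rangle=|x+a\rangle$ and $Z(b)|x\rangle=\omega_p^{{\rm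 tr}(bx)}|x\rangle$; $X_i(a)$, $Z_i(b)$ act as $X(a)$, $Z(b)$ on $Q_i$ and as the identity on all other qudits of $Q_{[n]}\cup B_{[c]}$. A quantum channel from $A$ to $C$ is a map $\mathcal M(A)\to\mathcal M(C)$ admitting a completely positive trace-preserving linear extension to all linear operators; equivalently (finite dimensions) $\rho\mapsto\sum_\nu K_\nu\rho K_\nu^\dagger$ for linear $K_\nu:\mathcal H_A\to\mathcal H_C$ with $\sum_\nu K_\nu^\dagger K_\nu=I_A$. *)

theory Defs
  imports Complex_Main "HOL-Library.FuncSet" "HOL-Library.Cardinality" "HOL-Library.Nonpos_Ints"
    "HOL-Computational_Algebra.Primes"
begin

text \<open>
  For a finite set \<open>I\<close>, linear operators \<open>\<complex>\<^sup>I \<rightarrow> \<complex>\<^sup>I\<close> are represented by their matrices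
  \<open>M x y = \<langle>x|M|y\<rangle>\<close> in the standard orthonormal basis. Matrices vanish outside \<open>I \<times> I\<close>, so that
  equality of operators is equality of functions.
\<close>

type_synonym 'i op = "'i \<Rightarrow> 'i \<Rightarrow> complex"

definition ops :: "'i set \<Rightarrow> 'i op set" where
  "ops I = {M. \<forall>x y. x \<notin> I \<or> y \<notin> I \<longrightarrow> M x y = 0}"

definition op_id :: "'i set \<Rightarrow> 'i op" where
  "op_id I = (\<lambda>x y. if x \<in> I \<and> x = y then 1 else 0)"

definition op_add :: "'i op \<Rightarrow> 'i op \<Rightarrow> 'i op" where
  "op_add M N = (\<lambda>x y. M x y + N x y)"

definition op_scale :: "complex \<Rightarrow> 'i op \<Rightarrow> 'i op" where
  "op_scale r M = (\<lambda>x y. r * M x y)"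

definition op_sum :: "('k \<Rightarrow> 'i op) \<Rightarrow> 'k set \<Rightarrow> 'i op" where
  "op_sum F K = (\<lambda>x y. \<Sum>k\<in>K. F k x y)"

definition op_mult :: "'i set \<Rightarrow> 'i op \<Rightarrow> 'i op \<Rightarrow> 'i op" where
  "op_mult I M N = (\<lambda>x y. if x \<in> I \<and> y \<in> I then \<Sum>z\<in>I. M x z * N z y else 0)"

definition op_adj :: "'i op \<Rightarrow> 'i op" where
  "op_adj M = (\<lambda>x y. cnj (M y x))"

definition op_trace :: "'i set \<Rightarrow> 'i op \<Rightarrow> complex" where
  "op_trace I M = (\<Sum>x\<in>I. M x x)"

definition psd :: "'i set \<Rightarrow> 'i op \<Rightarrow> bool" where
  "psd I M \<longleftrightarrow> M \<in> ops I \<and>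
     (\<forall>v :: 'i \<Rightarrow> complex. (\<Sum>x\<in>I. \<Sum>y\<in>I. cnj (v x) * M x y * v y) \<in> \<real>\<^sub>\<ge>\<^sub>0)"

definition density :: "'i set \<Rightarrow> 'i op set" where
  "density I = {\<rho>. psd I \<rho> \<and> op_trace I \<rho> = 1}"

definition linear_on_ops :: "'i set \<Rightarrow> 'j set \<Rightarrow> ('i op \<Rightarrow> 'j op) \<Rightarrow> bool" where
  "linear_on_ops I J \<Psi> \<longleftrightarrow>
     \<Psi> \<in> ops I \<rightarrow> ops J \<and>
     (\<forall>M\<in>ops I. \<forall>N\<in>ops I. \<Psi> (op_add M N) = op_add (\<Psi> M) (\<Psi> N)) \<and>
     (\<forall>r. \<forall>M\<in>ops I. \<Psi> (op_scale r M) = op_scale r (\<Psi> M))"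

text \<open>
  The map \<open>\<Psi> \<otimes> id\<close>, where the ancilla has a basis indexed by \<open>'k\<close>: an operator on
  \<open>\<complex>\<^sup>I \<otimes> \<complex>\<^sup>k\<close> is a block matrix \<open>\<Sum>\<^sub>s\<^sub>t R\<^sub>s\<^sub>t \<otimes> |s\<rangle>\<langle>t|\<close>, and \<open>\<Psi>\<close> is applied to each block \<open>R\<^sub>s\<^sub>t\<close>.
\<close>

definition ampliation :: "('i op \<Rightarrow> 'j op) \<Rightarrow> ('i \<times> 'k) op \<Rightarrow> ('j \<times> 'k) op" where
  "ampliation \<Psi> R = (\<lambda>(x, s) (y, t). \<Psi> (\<lambda>x' y'. R (x', s) (y', t)) x y)"

definition completely_positive :: "'i set \<Rightarrow> 'j set \<Rightarrow> ('i op \<Rightarrow> 'j op) \<Rightarrow> bool" where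
  "completely_positive I J \<Psi> \<longleftrightarrow>
     (\<forall>(k::nat) R. psd (I \<times> {..<k}) R \<longrightarrow> psd (J \<times> {..<k}) (ampliation \<Psi> R))"

definition trace_preserving :: "'i set \<Rightarrow> 'j set \<Rightarrow> ('i op \<Rightarrow> 'j op) \<Rightarrow> bool" where
  "trace_preserving I J \<Psi> \<longleftrightarrow> (\<forall>M\<in>ops I. op_trace J (\<Psi> M) = op_trace I M)"

text \<open>Only the values of \<open>\<Phi>\<close> on density operators matter here.\<close>

definition quantum_channel :: "'i set \<Rightarrow> 'j set \<Rightarrow> ('i op \<Rightarrow> 'j op) \<Rightarrow> bool" where
  "quantum_channel I J \<Phi> \<longleftrightarrow>
     \<Phi> \<in> density I \<rightarrow> density J \<and>
     (\<exists>\<Psi>. linear_on_ops I J \<Psi> \<and> completely_positive I J \<Psi> \<and> trace_preserving I J \<Psi> \<and>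
          (\<forall>\<rho>\<in>density I. \<Psi> \<rho> = \<Phi> \<rho>))"

datatype label = Q nat | B nat

definition register :: "nat \<Rightarrow> nat \<Rightarrow> label set" where
  "register n c = Q ` {1..n} \<union> B ` {1..c}"

text \<open>
  The product basis of the Hilbert space of a set \<open>A\<close> of qudits: an assignment \<open>x\<close> of field elements
  to the labels in \<open>A\<close> stands for the tensor product of the vectors \<open>|x s\<rangle>\<close>, \<open>s \<in> A\<close>. There is
  exactly one such assignment if \<open>A\<close> is empty, which gives the space \<open>\<complex>\<close>.
\<close>

definition basis :: "label set \<Rightarrow> (label \<Rightarrow> 'f) set" where
  "basis A = A \<rightarrow>\<^sub>E UNIV"

text \<open>
  \<open>tensor_at A s M N\<close> is \<open>M \<otimes> N\<close> on \<open>A\<close>, with the one-qudit operator \<open>M\<close> at position \<open>s\<close> and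
  the operator \<open>N\<close> on the remaining labels \<open>A - {s}\<close>.
\<close>

definition tensor_at :: "label set \<Rightarrow> label \<Rightarrow> 'f op \<Rightarrow> (label \<Rightarrow> 'f) op \<Rightarrow> (label \<Rightarrow> 'f) op" where
  "tensor_at A s M N = (\<lambda>x y. if x \<in> basis A \<and> y \<in> basis A
     then M (x s) (y s) * N (restrict x (A - {s})) (restrict y (A - {s})) else 0)"

definition partial_trace ::
    "label set \<Rightarrow> label \<Rightarrow> (label \<Rightarrow> 'f::finite) op \<Rightarrow> (label \<Rightarrow> 'f) op" where
  "partial_trace A s \<rho> = (\<lambda>x y. if x \<in> basis (A - {s}) \<and> y \<in> basis (A - {s})
     then \<Sum>a\<in>UNIV. \<rho> (x(s := a)) (y(s := a)) else 0)"

definition Gamma :: "label set \<Rightarrow> label \<Rightarrow> (label \<Rightarrow> 'f::finite) op \<Rightarrow> (label \<Rightarrow> 'f) op" where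
  "Gamma A s \<rho> =
     tensor_at A s (op_scale (1 / of_nat CARD('f)) (op_id UNIV)) (partial_trace A s \<rho>)"

text \<open>
  The trace of the field with \<open>p ^ m\<close> elements over its prime field, as the sum of the Galois
  conjugates. The prime field is regarded as a subset of the big field.
\<close>

definition field_trace :: "nat \<Rightarrow> nat \<Rightarrow> 'f::field \<Rightarrow> 'f" where
  "field_trace p m x = (\<Sum>j<m. x ^ (p ^ j))"

text \<open>
  \<open>\<omega>\<^sub>p\<close> to the power \<open>t\<close>, for \<open>t\<close> in the prime field, through the representative of \<open>t\<close> in
  \<open>{0..<p}\<close>.
\<close>

definition omega_pow :: "nat \<Rightarrow> 'f::field \<Rightarrow> complex" where
  "omega_pow p t = exp (2 * of_real pi * \<i> / of_nat p) ^ (LEAST k. of_nat k = t)"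

definition X_op :: "'f::field \<Rightarrow> 'f op" where
  "X_op a = (\<lambda>x y. if x = y + a then 1 else 0)"

definition Z_op :: "nat \<Rightarrow> nat \<Rightarrow> 'f::field \<Rightarrow> 'f op" where
  "Z_op p m b = (\<lambda>x y. if x = y then omega_pow p (field_trace p m (b * y)) else 0)"

definition X_at :: "label set \<Rightarrow> label \<Rightarrow> 'f::field \<Rightarrow> (label \<Rightarrow> 'f) op" where
  "X_at A s a = tensor_at A s (X_op a) (op_id (basis (A - {s})))"

definition Z_at :: "nat \<Rightarrow> nat \<Rightarrow> label set \<Rightarrow> label \<Rightarrow> 'f::field \<Rightarrow> (label \<Rightarrow> 'f) op" where
  "Z_at p m A s b = tensor_at A s (Z_op p m b) (op_id (basis (A - {s})))"

definition XZ_at :: "nat \<Rightarrow> nat \<Rightarrow> label set \<Rightarrow> label \<Rightarrow> 'f::field \<Rightarrow> 'f \<Rightarrow> (label \<Rightarrow> 'f) op" where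
  "XZ_at p m A s a b = op_mult (basis A) (X_at A s a) (Z_at p m A s b)"

end

theory Submission
  imports Defs "HOL-Computational_Algebra.Polynomial" "HOL-Number_Theory.Residues"
begin

text \<open>
  Conjugation by \<open>X(a) Z(b)\<close> multiplies the matrix entry at \<open>x, y\<close> by \<open>\<chi>(b (x\<^sub>i - y\<^sub>i))\<close>, where
  \<open>\<chi>(t) = \<omega>\<^sub>p\<close> to the power \<open>tr t\<close>, and shifts both \<open>i\<close>-th coordinates by \<open>a\<close>. As \<open>\<chi>\<close> is a
  nontrivial character (the trace is a polynomial of degree less than \<open>q\<close>, so it does not vanish
  identically), summing over \<open>b\<close> kills the entries with \<open>x\<^sub>i \<noteq> y\<^sub>i\<close>, and summing over \<open>a\<close> then gives
  the partial trace. This exhibits the unitaries \<open>X(a) Z(b)\<close>, divided by \<open>q\<close>, as Kraus operators.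
\<close>

section \<open>The additive characters of a finite field\<close>

text \<open>The characteristic of a finite field is prime and divides the order, hence divides a
  power of \<open>p\<close>.\<close>

lemma CHAR_finite_field:
  assumes "prime p" and "CARD('f::{field,finite}) = p ^ m"
  shows "CHAR('f) = p"
proof -
  have "prime CHAR('f)"
    by (simp add: finite_imp_CHAR_pos prime_CHAR_semidom)
  moreover have "CHAR('f) dvd p ^ m"
    using CHAR_dvd_CARD[where 'a='f] assms by simp
  ultimately show ?thesis
    using assms by (metis prime_dvd_power primes_dvd_imp_eq)
qed

lemma exponent_finite_field_pos:
  assumes "CARD('f::{field,finite}) = p ^ m"
  shows "m > 0"
proof (rule ccontr)
  assume "\<not> m > 0"
  then have "card (UNIV :: 'f set) = Suc 0" using assms by simp
  then obtain z :: 'f where z: "UNIV = {z}" by (auto simp: card_Suc_eq)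
  have "(0::'f) \<in> {z}" "(1::'f) \<in> {z}" unfolding z[symmetric] by auto
  then show False by simp
qed

text \<open>Multiplication by a nonzero \<open>x\<close> permutes the nonzero elements, so their
  product is unchanged and \<open>x\<close> to the power q - 1 is 1.\<close>

lemma power_CARD_eq_same:
  fixes x :: "'f::{field,finite}"
  shows "x ^ CARD('f) = x"
proof (cases "x = 0")
  case False
  have "(\<Prod>y\<in>UNIV-{0}. y) = (\<Prod>y\<in>UNIV-{0}. x * y)"
    by (rule prod.reindex_bij_witness[of _ "\<lambda>y. x * y" "\<lambda>y. y / x"]) (use False in auto)
  also have "\<dots> = x ^ (CARD('f) - 1) * (\<Prod>y\<in>UNIV-{0}. y)"
    by (simp add: prod.distrib)
  finally have "x ^ (CARD('f) - 1) = 1"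
    by simp
  then have "x ^ Suc (CARD('f) - 1) = x"
    by (simp only: power_Suc mult_1_right)
  also have "Suc (CARD('f) - 1) = CARD('f)"
    by (simp add: card_gt_0_iff)
  finally show ?thesis .
qed simp

section \<open>The field trace and the prime subfield\<close>

lemma field_trace_add:
  fixes x y :: "'f::{field,finite}"
  assumes "prime p" and "CARD('f) = p ^ m"
  shows "field_trace p m (x + y) = field_trace p m x + field_trace p m y"
  using assms by (simp add: field_trace_def sum.distrib[symmetric] CHAR_finite_field freshmans_dream')

text \<open>Frobenius permutes the summands of the trace cyclically. Fixed points of Frobenius are
  the prime subfield, so this places all trace values there.\<close>

lemma field_trace_power:
  fixes x :: "'f::{field,finite}"
  assumes "prime p" and "CARD('f) = p ^ m"
  shows "field_trace p m x ^ p = field_trace p m x"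
proof -
  have "field_trace p m x ^ p = (\<Sum>j<m. (x ^ (p ^ j)) ^ p)"
    unfolding field_trace_def
    by (rule freshmans_dream_sum) (use CHAR_finite_field[OF assms] assms in auto)
  also have "\<dots> = (\<Sum>j<m. x ^ (p ^ Suc j))"
    by (simp add: power_mult[symmetric] mult.commute)
  \<comment> \<open>The shifted sum lacks the term \<open>x\<close> at \<open>j = 0\<close>; the
    extra term at \<open>j = m\<close> equals \<open>x\<close> again and cancels the
    subtraction.\<close>
  also have "\<dots> = (\<Sum>j<Suc m. x ^ (p ^ j)) - x"
    by (subst sum.lessThan_Suc_shift) simp
  also have "\<dots> = (\<Sum>j<m. x ^ (p ^ j))"
    using power_CARD_eq_same[of x] assms by simp
  finally show ?thesis
    by (simp add: field_trace_def)
qed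

text \<open>The polynomial \<open>P\<close> has at most \<open>p\<close> roots, and the images of 0,
  ..., p - 1 are already \<open>p\<close> distinct ones.\<close>

lemma of_nat_eqI_power_prime:
  fixes t :: "'f::{field,finite}"
  assumes "prime p" and "CARD('f) = p ^ m" and "t ^ p = t"
  shows "\<exists>k<p. t = of_nat k"
proof -
  define P where "P = Polynomial.monom (1::'f) p - [:0, 1:]"
  have p1: "p > 1" using assms(1) by (rule prime_gt_1_nat)
  have "Polynomial.coeff P p = 1"
    using p1 by (auto simp: P_def coeff_pCons split: nat.splits)
  then have "P \<noteq> 0" by auto
  moreover have "Polynomial.degree P \<le> p"
    unfolding P_def using p1 by (intro degree_diff_le degree_monom_le) auto
  ultimately have "card {x. poly P x = 0} \<le> p"
    using card_poly_roots_bound le_trans by blast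
  moreover have roots: "{x. poly P x = 0} = {x. x ^ p = x}"
    by (simp add: P_def poly_monom)
  moreover have "card (of_nat ` {..<p} :: 'f set) = p"
  proof -
    have "inj_on (of_nat :: nat \<Rightarrow> 'f) {..<p}"
      using CHAR_finite_field[OF assms(1,2)]
      by (auto simp: inj_on_def of_nat_eq_iff_cong_CHAR cong_def)
    then show ?thesis by (simp add: card_image)
  qed
  moreover have "of_nat ` {..<p} \<subseteq> {x::'f. x ^ p = x}"
  proof -
    \<comment> \<open>Fermat's little theorem, by induction through the freshman's dream.\<close>
    have "(of_nat k :: 'f) ^ p = of_nat k" for k
    proof (induction k)
      case (Suc k)
      have "(1 + of_nat k :: 'f) ^ p = 1 ^ p + of_nat k ^ p"
        by (rule freshmans_dream) (simp_all add: CHAR_finite_field[OF assms(1,2)] assms(1))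
      with Suc show ?case by simp
    qed (use p1 in simp)
    then show ?thesis by auto
  qed
  ultimately have "of_nat ` {..<p} = {x::'f. x ^ p = x}"
    by (intro card_seteq) auto
  with assms(3) show ?thesis by auto
qed

lemma field_trace_nonzero:
  assumes "prime p" and "CARD('f::{field,finite}) = p ^ m"
  shows "\<exists>x::'f. field_trace p m x \<noteq> 0"
proof (rule ccontr)
  assume "\<not> ?thesis"
  then have tr0: "\<And>x::'f. field_trace p m x = 0" by auto
  define P where "P = (\<Sum>j<m. Polynomial.monom (1::'f) (p ^ j))"
  have m: "m > 0" using assms(2) by (rule exponent_finite_field_pos)
  have p1: "p > 1" using assms(1) by (rule prime_gt_1_nat)
  \<comment> \<open>The exponents \<open>p ^ j\<close> are distinct because \<open>p > 1\<close>, so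
    only the last monomial contributes to the top coefficient.\<close>
  have "Polynomial.coeff P (p ^ (m - 1)) = (\<Sum>j<m. if j = m - 1 then 1 else 0)"
    unfolding P_def coeff_sum using p1 by (intro sum.cong) auto
  then have "Polynomial.coeff P (p ^ (m - 1)) = 1" using m by simp
  then have "P \<noteq> 0" by auto
  moreover have "Polynomial.degree P \<le> p ^ (m - 1)"
    unfolding P_def using p1 m
    by (intro degree_sum_le) (auto simp: degree_monom_eq intro!: power_increasing)
  ultimately have "card {x. poly P x = 0} \<le> p ^ (m - 1)"
    using card_poly_roots_bound le_trans by blast
  moreover have "poly P x = 0" for x
    using tr0[of x] by (simp add: P_def poly_sum poly_monom field_trace_def)
  ultimately have "p ^ m \<le> p ^ (m - 1)"
    using assms(2) by simp
  then show False
    using p1 m power_strict_increasing[of "m - 1" m p] by linarith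
qed

text \<open>The least representative chosen in \<open>omega_pow\<close> may be replaced by any
  other: the two agree modulo \<open>p\<close>, and the root of unity has \<open>p\<close>-th power
  1.\<close>

lemma omega_pow_of_nat:
  assumes "prime p" and "CARD('f::{field,finite}) = p ^ m"
  shows "omega_pow p (of_nat k :: 'f) = cis (2 * pi / p) ^ k"
proof -
  let ?l = "LEAST l. of_nat l = (of_nat k :: 'f)"
  have p: "p > 0" using assms(1) by (rule prime_gt_0_nat)
  have "of_nat ?l = (of_nat k :: 'f)" by (rule LeastI) simp
  then have "[?l = k] (mod p)"
    using CHAR_finite_field[OF assms] by (simp add: of_nat_eq_iff_cong_CHAR)
  moreover have "cis (2 * pi / p) ^ p = 1"
    using p by (simp add: DeMoivre)
  then have "cis (2 * pi / p) ^ l = cis (2 * pi / p) ^ (l mod p)" for l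
    by (metis div_mult_mod_eq mult.commute mult_1 power_add power_mult power_one)
  ultimately have "cis (2 * pi / p) ^ ?l = cis (2 * pi / p) ^ k"
    by (metis cong_def)
  then show ?thesis
    by (simp add: omega_pow_def cis_conv_exp mult_ac)
qed

section \<open>The canonical additive character and its orthogonality relation\<close>

definition trace_char :: "nat \<Rightarrow> nat \<Rightarrow> 'f::field \<Rightarrow> complex" where
  "trace_char p m x = omega_pow p (field_trace p m x)"

text \<open>Trace values have natural number representatives, so additivity of the trace becomes
  addition of exponents.\<close>

lemma trace_char_add:
  fixes x y :: "'f::{field,finite}"
  assumes "prime p" and "CARD('f) = p ^ m"
  shows "trace_char p m (x + y) = trace_char p m x * trace_char p m y"
proof -
  obtain k l where "field_trace p m x = of_nat k" "field_trace p m y = of_nat l"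
    using of_nat_eqI_power_prime[OF assms field_trace_power[OF assms]] by metis
  then show ?thesis
    using omega_pow_of_nat[OF assms] 
    by (simp add: trace_char_def field_trace_add[OF assms] power_add flip: of_nat_add)
qed

lemma norm_trace_char: "norm (trace_char p m x) = 1"
  by (simp add: trace_char_def omega_pow_def norm_power)

text \<open>For values of modulus one the conjugate is the inverse. This is the form in which the
  phases of an operator and its adjoint meet under conjugation.\<close>

lemma trace_char_diff:
  fixes x y :: "'f::{field,finite}"
  assumes "prime p" and "CARD('f) = p ^ m"
  shows "trace_char p m (x - y) = trace_char p m x * cnj (trace_char p m y)"
proof -
  have "trace_char p m y * cnj (trace_char p m y) = 1"
    by (simp add: complex_norm_square[symmetric] norm_trace_char)
  then show ?thesis
    using trace_char_add[OF assms, of "x - y" y] by (simp add: mult.assoc)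
qed

text \<open>A nonzero trace value has a representative strictly between 0 and \<open>p\<close>, and
  the \<open>p\<close>-th roots of unity with exponents below \<open>p\<close> are distinct.\<close>

lemma trace_char_nontrivial:
  assumes "prime p" and "CARD('f::{field,finite}) = p ^ m"
  shows "\<exists>x::'f. trace_char p m x \<noteq> 1"
proof -
  obtain x :: 'f where x: "field_trace p m x \<noteq> 0"
    using field_trace_nonzero[OF assms] by blast
  obtain k where k: "k < p" "field_trace p m x = of_nat k"
    using of_nat_eqI_power_prime[OF assms field_trace_power[OF assms]] by metis
  have "k \<noteq> 0" using x k by (metis of_nat_0)
  moreover have "inj_on (\<lambda>k. cis (2 * pi * real k / real p)) {..<p}"
    using bij_betw_roots_unity[of p] k by (auto simp: bij_betw_def)
  ultimately have "cis (2 * pi * real k / p) \<noteq> cis (2 * pi * real 0 / p)"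
    using inj_onD[of _ "{..<p}" k 0] k by force
  then have "trace_char p m x \<noteq> 1"
    using k omega_pow_of_nat[OF assms, of k] by (simp add: trace_char_def DeMoivre mult_ac)
  then show ?thesis ..
qed

text \<open>For \<open>d \<noteq> 0\<close>, translating \<open>b\<close> by \<open>x / d\<close>
  multiplies the sum by the character value at \<open>x\<close>, which can be chosen different from
  1.\<close>

lemma sum_trace_char:
  fixes d :: "'f::{field,finite}"
  assumes "prime p" and "CARD('f) = p ^ m"
  shows "(\<Sum>b\<in>UNIV. trace_char p m (b * d)) = (if d = 0 then of_nat CARD('f) else 0)"
proof (cases "d = 0")
  case True
  have "trace_char p m (0::'f) = 1"
    using trace_char_diff[OF assms, of 0 0]
    by (simp add: complex_norm_square[symmetric] norm_trace_char)
  with True show ?thesis by simp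
next
  case False
  obtain x :: 'f where x: "trace_char p m x \<noteq> 1"
    using trace_char_nontrivial[OF assms] by blast
  let ?S = "\<Sum>b\<in>UNIV. trace_char p m (b * d)"
  have "?S = (\<Sum>b\<in>UNIV. trace_char p m ((b + x / d) * d))"
    by (rule sum.reindex_bij_witness[of _ "\<lambda>b. b + x / d" "\<lambda>b. b - x / d"]) auto
  also have "\<dots> = trace_char p m x * ?S"
    using False by (simp add: distrib_right trace_char_add[OF assms] sum_distrib_right
        mult.commute[of "trace_char p m x"])
  finally have "?S = 0" using x by simp
  with False show ?thesis by simp
qed

section \<open>Kraus representations\<close>

definition kraus_map :: "'i set \<Rightarrow> 'k set \<Rightarrow> ('k \<Rightarrow> 'i op) \<Rightarrow> 'i op \<Rightarrow> 'i op" where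
  "kraus_map I N K M = op_sum (\<lambda>\<nu>. op_mult I (op_mult I (K \<nu>) M) (op_adj (K \<nu>))) N"

lemma sum_nonneg_Reals: "(\<And>x. x \<in> S \<Longrightarrow> f x \<in> \<real>\<^sub>\<ge>\<^sub>0) \<Longrightarrow> sum f S \<in> \<real>\<^sub>\<ge>\<^sub>0"
  by (induction S rule: infinite_finite_induct) auto

lemma psd_op_sum:
  assumes "\<And>\<nu>. \<nu> \<in> N \<Longrightarrow> psd I (F \<nu>)"
  shows "psd I (op_sum F N)"
proof -
  have "(\<Sum>x\<in>I. \<Sum>y\<in>I. cnj (v x) * op_sum F N x y * v y) =
        (\<Sum>\<nu>\<in>N. \<Sum>x\<in>I. \<Sum>y\<in>I. cnj (v x) * F \<nu> x y * v y)" for v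
    unfolding op_sum_def sum_distrib_left sum_distrib_right
    by (subst (2) sum.swap, subst sum.swap) (rule refl)
  moreover have "op_sum F N \<in> ops I"
    using assms by (auto simp: psd_def ops_def op_sum_def intro!: sum.neutral)
  ultimately show ?thesis
    using assms by (simp add: psd_def sum_nonneg_Reals)
qed

text \<open>The operator \<open>K\<close> is moved onto the vectors, giving the form of
  \<open>M\<close> at the images of \<open>v\<close> and \<open>v'\<close> under the adjoint of
  \<open>K\<close>. Two vectors are allowed because off-diagonal ancilla blocks pair different
  components.\<close>

lemma sum_conjugate:
  fixes K M :: "'i op"
  shows "(\<Sum>x\<in>I. \<Sum>y\<in>I. cnj (v x) * op_mult I (op_mult I K M) (op_adj K) x y * v' y) =
    (\<Sum>w\<in>I. \<Sum>z\<in>I. cnj (\<Sum>x\<in>I. cnj (K x w) * v x) * M w z * (\<Sum>y\<in>I. cnj (K y z) * v' y))"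
proof -
  let ?f = "\<lambda>x y z w. cnj (v x) * K x w * M w z * cnj (K y z) * v' y"
  have "(\<Sum>x\<in>I. \<Sum>y\<in>I. cnj (v x) * op_mult I (op_mult I K M) (op_adj K) x y * v' y) =
    (\<Sum>x\<in>I. \<Sum>y\<in>I. \<Sum>z\<in>I. \<Sum>w\<in>I. ?f x y z w)"
    by (simp add: op_mult_def op_adj_def sum_distrib_left sum_distrib_right mult.assoc)
  also have "\<dots> = (\<Sum>((x, y), z, w)\<in>(I \<times> I) \<times> I \<times> I. ?f x y z w)"
    by (simp add: split_def sum.cartesian_product')
  also have "\<dots> = (\<Sum>((w, z), x, y)\<in>(I \<times> I) \<times> I \<times> I. ?f x y z w)"
    by (rule sum.reindex_bij_witness[of _ "\<lambda>((w, z), x, y). ((x, y), z, w)"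
          "\<lambda>((x, y), z, w). ((w, z), x, y)"]) auto
  also have "\<dots> = (\<Sum>w\<in>I. \<Sum>z\<in>I. \<Sum>x\<in>I. \<Sum>y\<in>I. ?f x y z w)"
    by (simp add: split_def sum.cartesian_product')
  also have "\<dots> = (\<Sum>w\<in>I. \<Sum>z\<in>I. cnj (\<Sum>x\<in>I. cnj (K x w) * v x) * M w z *
      (\<Sum>y\<in>I. cnj (K y z) * v' y))"
    by (simp add: sum_distrib_left sum_distrib_right mult.commute mult.left_commute)
  finally show ?thesis .
qed

lemma psd_conjugate:
  assumes "psd I M"
  shows "psd I (op_mult I (op_mult I K M) (op_adj K))"
proof -
  have "(\<Sum>w\<in>I. \<Sum>z\<in>I. cnj (u w) * M w z * u z) \<in> \<real>\<^sub>\<ge>\<^sub>0" for u :: "'a \<Rightarrow> complex"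
    using assms by (simp add: psd_def)
  then have "(\<Sum>x\<in>I. \<Sum>y\<in>I. cnj (v x) * op_mult I (op_mult I K M) (op_adj K) x y * v y) \<in> \<real>\<^sub>\<ge>\<^sub>0" for v
    by (simp only: sum_conjugate)
  then show ?thesis
    by (simp add: psd_def ops_def op_mult_def)
qed

lemma psd_kraus_map: "psd I M \<Longrightarrow> psd I (kraus_map I N K M)"
  unfolding kraus_map_def by (intro psd_op_sum psd_conjugate)

section \<open>Linearity of Kraus maps\<close>

lemma op_mult_op_add:
  "op_mult I (op_add M M') N = op_add (op_mult I M N) (op_mult I M' N)"
  "op_mult I M (op_add N N') = op_add (op_mult I M N) (op_mult I M N')"
  by (auto simp: fun_eq_iff op_mult_def op_add_def distrib_left distrib_right sum.distrib)

lemma op_mult_op_scale: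
  "op_mult I (op_scale r M) N = op_scale r (op_mult I M N)"
  "op_mult I M (op_scale r N) = op_scale r (op_mult I M N)"
  by (auto simp: fun_eq_iff op_mult_def op_scale_def sum_distrib_left mult.assoc mult.left_commute)

lemma op_adj_op_scale: "op_adj (op_scale r M) = op_scale (cnj r) (op_adj M)"
  by (simp add: op_adj_def op_scale_def)

lemma op_scale_op_scale: "op_scale r (op_scale r' M) = op_scale (r * r') M"
  by (simp add: op_scale_def mult.assoc)

lemma op_sum_op_add: "op_sum (\<lambda>k. op_add (F k) (G k)) N = op_add (op_sum F N) (op_sum G N)"
  by (simp add: op_sum_def op_add_def sum.distrib)

lemma op_sum_op_scale: "op_sum (\<lambda>k. op_scale r (F k)) N = op_scale r (op_sum F N)"
  by (simp add: op_sum_def op_scale_def sum_distrib_left)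

lemma linear_on_ops_kraus_map: "linear_on_ops I I (kraus_map I N K)"
proof -
  have "kraus_map I N K M \<in> ops I" for M
    by (auto simp: kraus_map_def ops_def op_sum_def op_mult_def)
  then show ?thesis
    by (simp add: linear_on_ops_def kraus_map_def op_mult_op_add op_mult_op_scale
        op_sum_op_add op_sum_op_scale)
qed

text \<open>The ampliation is conjugation by the tensor product of \<open>K\<close> with the
  identity, so its form is that of \<open>R\<close> at a transformed vector.\<close>

lemma psd_ampliation_conjugate:
  assumes "psd (I \<times> S) R"
  shows "psd (I \<times> S) (ampliation (\<lambda>M. op_mult I (op_mult I K M) (op_adj K)) R)"
proof -
  let ?A = "ampliation (\<lambda>M. op_mult I (op_mult I K M) (op_adj K)) R"
  \<comment> \<open>With the ancilla indices outermost, the inner double sums run over single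
    blocks, to which \<open>sum_conjugate\<close> applies.\<close>
  have reorder: "(\<Sum>a\<in>I \<times> S. \<Sum>b\<in>I \<times> S. cnj (v a) * T a b * v b) =
      (\<Sum>s\<in>S. \<Sum>t\<in>S. \<Sum>x\<in>I. \<Sum>y\<in>I. cnj (v (x, s)) * T (x, s) (y, t) * v (y, t))"
    for v :: "'a \<times> 'b \<Rightarrow> complex" and T
  proof -
    have "(\<Sum>a\<in>I \<times> S. \<Sum>b\<in>I \<times> S. cnj (v a) * T a b * v b) =
      (\<Sum>((x, s), y, t)\<in>(I \<times> S) \<times> I \<times> S. cnj (v (x, s)) * T (x, s) (y, t) * v (y, t))"
      by (simp add: split_def sum.cartesian_product')
    also have "\<dots> =
      (\<Sum>((s, t), x, y)\<in>(S \<times> S) \<times> I \<times> I. cnj (v (x, s)) * T (x, s) (y, t) * v (y, t))"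
      by (rule sum.reindex_bij_witness[of _ "\<lambda>((s, t), x, y). ((x, s), y, t)"
            "\<lambda>((x, s), y, t). ((s, t), x, y)"]) auto
    also have "\<dots> =
      (\<Sum>s\<in>S. \<Sum>t\<in>S. \<Sum>x\<in>I. \<Sum>y\<in>I. cnj (v (x, s)) * T (x, s) (y, t) * v (y, t))"
      by (simp add: split_def sum.cartesian_product')
    finally show ?thesis .
  qed
  \<comment> \<open>The vector \<open>u\<close> is \<open>v\<close> with the adjoint of
    \<open>K\<close> applied to its system part for each fixed ancilla index.\<close>
  have "(\<Sum>a\<in>I \<times> S. \<Sum>b\<in>I \<times> S. cnj (v a) * ?A a b * v b) =
      (\<Sum>a\<in>I \<times> S. \<Sum>b\<in>I \<times> S. cnj (u a) * R a b * u b)"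
    if "u = (\<lambda>(w, s). \<Sum>x\<in>I. cnj (K x w) * v (x, s))" for u v
    unfolding reorder that ampliation_def split_conv by (subst sum_conjugate) (rule refl)
  then have "(\<Sum>a\<in>I \<times> S. \<Sum>b\<in>I \<times> S. cnj (v a) * ?A a b * v b) \<in> \<real>\<^sub>\<ge>\<^sub>0" for v
    using assms by (simp add: psd_def)
  moreover have "?A \<in> ops (I \<times> S)"
    using assms by (auto simp: psd_def ops_def ampliation_def op_mult_def)
  ultimately show ?thesis
    using assms by (simp add: psd_def)
qed

lemma completely_positive_kraus_map: "completely_positive I I (kraus_map I N K)"
proof -
  have "ampliation (kraus_map I N K) R =
      op_sum (\<lambda>\<nu>. ampliation (\<lambda>M. op_mult I (op_mult I (K \<nu>) M) (op_adj (K \<nu>))) R) N"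
    for R :: "('a \<times> nat) op"
    by (auto simp: fun_eq_iff ampliation_def kraus_map_def op_sum_def)
  then show ?thesis
    by (simp add: completely_positive_def psd_op_sum psd_ampliation_conjugate)
qed

text \<open>Cyclicity of the trace gathers the Kraus operators into the completeness sum, whose
  entries are supplied by \<open>eq\<close>.\<close>

lemma trace_preserving_kraus_map:
  assumes "finite N" "finite I" "op_sum (\<lambda>\<nu>. op_mult I (op_adj (K \<nu>)) (K \<nu>)) N = op_id I"
  shows "trace_preserving I I (kraus_map I N K)"
proof -
  have "op_trace I (kraus_map I N K M) = op_trace I M" for M
  proof -
    have eq: "(\<Sum>\<nu>\<in>N. \<Sum>x\<in>I. cnj (K \<nu> x z) * K \<nu> x w) = (if z = w then 1 else 0)"
      if "z \<in> I" "w \<in> I" for z w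
      using fun_cong[OF fun_cong[OF assms(3)], of z w] that
      by (simp add: op_sum_def op_mult_def op_adj_def op_id_def)
    have "op_trace I (kraus_map I N K M) =
        (\<Sum>x\<in>I. \<Sum>\<nu>\<in>N. \<Sum>z\<in>I. \<Sum>w\<in>I. K \<nu> x w * M w z * cnj (K \<nu> x z))"
      by (simp add: op_trace_def kraus_map_def op_sum_def op_mult_def op_adj_def sum_distrib_right)
    also have "\<dots> = (\<Sum>((x, \<nu>), z, w)\<in>(I \<times> N) \<times> I \<times> I. K \<nu> x w * M w z * cnj (K \<nu> x z))"
      by (simp add: split_def sum.cartesian_product')
    also have "\<dots> = (\<Sum>((z, w), \<nu>, x)\<in>(I \<times> I) \<times> N \<times> I. K \<nu> x w * M w z * cnj (K \<nu> x z))"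
      by (rule sum.reindex_bij_witness[of _ "\<lambda>((z, w), \<nu>, x). ((x, \<nu>), z, w)"
            "\<lambda>((x, \<nu>), z, w). ((z, w), \<nu>, x)"]) auto
    also have "\<dots> = (\<Sum>z\<in>I. \<Sum>w\<in>I. \<Sum>\<nu>\<in>N. \<Sum>x\<in>I. K \<nu> x w * M w z * cnj (K \<nu> x z))"
      by (simp add: split_def sum.cartesian_product')
    also have "\<dots> = (\<Sum>z\<in>I. \<Sum>w\<in>I. M w z * (\<Sum>\<nu>\<in>N. \<Sum>x\<in>I. cnj (K \<nu> x z) * K \<nu> x w))"
      by (simp add: sum_distrib_left mult_ac)
    also have "\<dots> = (\<Sum>z\<in>I. \<Sum>w\<in>I. if z = w then M w z else 0)"
      by (intro sum.cong refl) (simp add: eq)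
    also have "\<dots> = op_trace I M"
      using assms by (simp add: op_trace_def)
    finally show ?thesis .
  qed
  then show ?thesis by (simp add: trace_preserving_def)
qed

lemma quantum_channel_kraus_map:
  assumes "finite N" "finite I" "op_sum (\<lambda>\<nu>. op_mult I (op_adj (K \<nu>)) (K \<nu>)) N = op_id I"
  shows "quantum_channel I I (kraus_map I N K)"
proof -
  have tp: "trace_preserving I I (kraus_map I N K)"
    using assms by (rule trace_preserving_kraus_map)
  then have "kraus_map I N K \<in> density I \<rightarrow> density I"
    using psd_kraus_map[of I _ N K] by (auto simp: density_def trace_preserving_def psd_def[of I])
  with tp show ?thesis
    using linear_on_ops_kraus_map completely_positive_kraus_map
    unfolding quantum_channel_def by blast
qed

section \<open>Twirling one qudit\<close>

lemma finite_basis: "finite A \<Longrightarrow> finite (basis A :: (label \<Rightarrow> 'f::finite) set)"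
  unfolding basis_def by (rule finite_PiE) auto

lemma basis_fun_upd:
  fixes x :: "label \<Rightarrow> 'f"
  shows "x \<in> basis A \<Longrightarrow> s \<in> A \<Longrightarrow> x(s := a) \<in> basis A"
  by (auto simp: basis_def PiE_def extensional_def)

lemma restrict_mem_basis: "restrict x (A - {s}) \<in> basis (A - {s})"
  by (auto simp: basis_def)

text \<open>The identity factor of \<open>tensor_at\<close> forces agreement away from
  \<open>s\<close>; solving this for \<open>y\<close> lets later sums collapse to a single
  term.\<close>

lemma restrict_eq_iff_fun_upd:
  assumes "x \<in> basis A" "y \<in> basis A"
  shows "restrict x (A - {s}) = restrict y (A - {s}) \<longleftrightarrow> y = x(s := y s)"
proof
  assume eq: "restrict x (A - {s}) = restrict y (A - {s})"
  have "y t = x t" if "t \<noteq> s" for t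
  proof (cases "t \<in> A")
    case True
    then show ?thesis
      using fun_cong[OF eq, of t] that by simp
  next
    case False
    \<comment> \<open>Extensional functions take the common default value outside
      \<open>A\<close>.\<close>
    have "x t = undefined" "y t = undefined"
      using assms PiE_arb[OF _ False] by (auto simp: basis_def)
    then show ?thesis by simp
  qed
  then show "y = x(s := y s)"
    by (intro ext) simp
next
  assume "y = x(s := y s)"
  then show "restrict x (A - {s}) = restrict y (A - {s})"
    by (intro restrict_ext) (metis DiffE fun_upd_other singletonI)
qed

lemma restrict_fun_upd_basis:
  assumes "x \<in> basis A" "s \<in> A"
  shows "(restrict x (A - {s}))(s := a) = x(s := a)"
  using assms by (auto simp: basis_def PiE_def extensional_def restrict_def fun_eq_iff)

section \<open>Matrix entries of the shift and phase operators\<close>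

lemma X_at_apply:
  assumes "s \<in> A" "x \<in> basis A"
  shows "X_at A s a x y = (if y = x(s := x s - a) then 1 else 0)"
proof (cases "y \<in> basis A")
  case True
  have "X_at A s a x y =
      (if x s = y s + a \<and> restrict x (A - {s}) = restrict y (A - {s}) then 1 else 0)"
    using assms True by (simp add: X_at_def tensor_at_def X_op_def op_id_def restrict_mem_basis)
  also have "x s = y s + a \<and> restrict x (A - {s}) = restrict y (A - {s}) \<longleftrightarrow>
      y = x(s := x s - a)"
    unfolding restrict_eq_iff_fun_upd[OF assms(2) True]
    by (metis add_diff_cancel diff_add_cancel fun_upd_same)
  finally show ?thesis .
next
  case False
  then show ?thesis
    using assms basis_fun_upd[of x A s] by (auto simp: X_at_def tensor_at_def)
qed

lemma Z_at_apply:
  assumes "s \<in> A" "x \<in> basis A"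
  shows "Z_at p m A s b x y = (if x = y then trace_char p m (b * x s) else 0)"
proof (cases "y \<in> basis A")
  case True
  have "Z_at p m A s b x y =
      (if x s = y s \<and> restrict x (A - {s}) = restrict y (A - {s})
       then trace_char p m (b * x s) else 0)"
    using assms True
    by (simp add: Z_at_def tensor_at_def Z_op_def op_id_def restrict_mem_basis trace_char_def)
  also have "x s = y s \<and> restrict x (A - {s}) = restrict y (A - {s}) \<longleftrightarrow> x = y"
    unfolding restrict_eq_iff_fun_upd[OF assms(2) True] by (metis fun_upd_triv)
  finally show ?thesis .
next
  case False
  then show ?thesis
    using assms by (auto simp: Z_at_def tensor_at_def)
qed

text \<open>Each row has a single nonzero entry. The phase is read at the column, since
  \<open>Z\<close> acts before the shift.\<close>

lemma XZ_at_apply: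
  fixes x y :: "label \<Rightarrow> 'f::{field,finite}"
  assumes "finite A" "s \<in> A" "x \<in> basis A"
  shows "XZ_at p m A s a b x y = (if y = x(s := x s - a) then trace_char p m (b * y s) else 0)"
proof -
  have "XZ_at p m A s a b x y = (if y \<in> basis A then
      \<Sum>z\<in>basis A. if z = x(s := x s - a) then Z_at p m A s b z y else 0 else 0)"
    using assms
    by (auto simp: XZ_at_def op_mult_def X_at_apply if_distrib[of "\<lambda>u. u * _"]
        cong: if_cong intro!: sum.cong)
  then show ?thesis
    using assms basis_fun_upd[of x A s "x s - a"]
    by (auto simp: finite_basis sum.delta Z_at_apply)
qed

text \<open>Both matrix products collapse to one term each, with phases at \<open>x s - a\<close>
  and \<open>y s - a\<close>; their combination depends only on the difference, in which
  \<open>a\<close> cancels.\<close>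

lemma conjugate_XZ_at:
  fixes x y :: "label \<Rightarrow> 'f::{field,finite}"
  assumes "prime p" "CARD('f) = p ^ m" "finite A" "s \<in> A" "x \<in> basis A" "y \<in> basis A"
  shows "op_mult (basis A) (op_mult (basis A) (XZ_at p m A s a b) \<rho>)
      (op_adj (XZ_at p m A s a b)) x y =
    trace_char p m (b * (x s - y s)) * \<rho> (x(s := x s - a)) (y(s := y s - a))"
proof -
  have "(\<Sum>w\<in>basis A. XZ_at p m A s a b x w * f w) = 
      trace_char p m (b * (x s - a)) * f (x(s := x s - a))" if "x \<in> basis A"
    for x and f :: "(label \<Rightarrow> 'f) \<Rightarrow> complex"
    using assms(3,4) that basis_fun_upd[of x A s "x s - a"]
    by (simp add: XZ_at_apply if_distrib[of "\<lambda>u. u * _"] finite_basis sum.delta cong: if_cong)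
  moreover have "(\<Sum>w\<in>basis A. f w * cnj (XZ_at p m A s a b y w)) = 
      f (y(s := y s - a)) * cnj (trace_char p m (b * (y s - a)))"
    for f :: "(label \<Rightarrow> 'f) \<Rightarrow> complex"
    using assms(3,4,6) basis_fun_upd[of y A s "y s - a"]
    by (simp add: XZ_at_apply if_distrib[of "\<lambda>u. _ * cnj u"] finite_basis sum.delta cong: if_cong)
  moreover have "b * (x s - y s) = b * (x s - a) - b * (y s - a)"
    by (simp add: algebra_simps)
  ultimately show ?thesis
    using assms basis_fun_upd[of y A s "y s - a"]
    by (simp add: op_mult_def op_adj_def trace_char_diff[OF assms(1,2)])
qed

section \<open>The twirl identity and the channel property\<close>

lemma Gamma_eq_sum_XZ_at:
  fixes \<rho> :: "(label \<Rightarrow> 'f::{field,finite}) op"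
  assumes "prime p" "CARD('f) = p ^ m" "finite A" "s \<in> A"
  shows "Gamma A s \<rho> =
    op_scale (1 / of_nat CARD('f) ^ 2)
      (op_sum (\<lambda>(a, b). op_mult (basis A) (op_mult (basis A) (XZ_at p m A s a b) \<rho>)
         (op_adj (XZ_at p m A s a b))) UNIV)" (is "_ = op_scale _ (op_sum ?T UNIV)")
proof (intro ext)
  fix x y :: "label \<Rightarrow> 'f"
  show "Gamma A s \<rho> x y = op_scale (1 / of_nat CARD('f) ^ 2) (op_sum ?T UNIV) x y"
  proof (cases "x \<in> basis A \<and> y \<in> basis A")
    case True
    let ?g = "\<lambda>a. \<rho> (x(s := x s - a)) (y(s := y s - a))"
    have "op_sum ?T UNIV x y =
        (\<Sum>(a, b)\<in>UNIV \<times> UNIV. trace_char p m (b * (x s - y s)) * ?g a)"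
      unfolding op_sum_def using True assms
      by (intro sum.cong) (auto simp: conjugate_XZ_at)
    also have "\<dots> = (\<Sum>a\<in>UNIV. \<Sum>b\<in>UNIV. trace_char p m (b * (x s - y s)) * ?g a)"
      by (rule sum.cartesian_product[symmetric])
    \<comment> \<open>Orthogonality in \<open>b\<close> kills the entries off the diagonal in
      coordinate \<open>s\<close> and yields a factor q elsewhere. It cancels one q of the
      prefactor; the other is the normalization of the mixed state in \<open>Gamma\<close>.\<close>
    also have "\<dots> = (if x s = y s then of_nat CARD('f) * (\<Sum>a\<in>UNIV. ?g a) else 0)"
      by (simp add: sum_distrib_right[symmetric] sum_trace_char[OF assms(1,2)] sum_distrib_left)
    also have "\<dots> = (if x s = y s then of_nat CARD('f) *
        (\<Sum>a\<in>UNIV. \<rho> (x(s := a)) (y(s := a))) else 0)"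
    proof -
      \<comment> \<open>On the diagonal both coordinates are \<open>y s - a\<close>, and this
        reflection is an involution of the field.\<close>
      have "(\<Sum>a\<in>UNIV. \<rho> (x(s := y s - a)) (y(s := y s - a))) =
          (\<Sum>a\<in>UNIV. \<rho> (x(s := a)) (y(s := a)))"
        by (rule sum.reindex_bij_witness[of _ "\<lambda>a. y s - a" "\<lambda>a. y s - a"]) auto
      then show ?thesis by simp
    qed
    finally show ?thesis
      using True assms(4)
      by (simp add: op_scale_def Gamma_def tensor_at_def op_id_def partial_trace_def
          restrict_mem_basis restrict_fun_upd_basis power2_eq_square del: restrict_upd)
  next
    case False
    then show ?thesis
      by (auto simp: op_scale_def op_sum_def op_mult_def Gamma_def tensor_at_def intro!: sum.neutral)
  qed
qed

text \<open>Each column has one nonzero entry, of modulus one, and distinct columns have theirs in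
  distinct rows.\<close>

lemma XZ_at_unitary:
  assumes "finite A" "s \<in> A"
  shows "op_mult (basis A) (op_adj (XZ_at p m A s a b)) (XZ_at p m A s a b) =
    (op_id (basis A) :: (label \<Rightarrow> 'f::{field,finite}) op)"
proof (intro ext)
  fix x y :: "label \<Rightarrow> 'f"
  show "op_mult (basis A) (op_adj (XZ_at p m A s a b)) (XZ_at p m A s a b) x y = op_id (basis A) x y"
  proof (cases "x \<in> basis A \<and> y \<in> basis A")
    case True
    \<comment> \<open>The row description of the entries is inverted, since the product with the
      adjoint on the left sums over rows.\<close>
    have shift: "x = z(s := z s - a) \<longleftrightarrow> z = x(s := x s + a)" for x z :: "label \<Rightarrow> 'f"
      by (auto simp: fun_eq_iff)
    have "(\<Sum>z\<in>basis A. cnj (XZ_at p m A s a b z x) * XZ_at p m A s a b z y) =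
      (\<Sum>z\<in>basis A. if z = x(s := x s + a) then
          (if x = y then cnj (trace_char p m (b * x s)) * trace_char p m (b * x s) else 0) else 0)"
      using assms by (intro sum.cong refl) (auto simp: XZ_at_apply shift[symmetric])
    also have "\<dots> = (if x = y then 1 else 0)"
      using True assms basis_fun_upd[of x A s "x s + a"]
      by (simp add: finite_basis mult.commute[of "cnj _"] complex_norm_square[symmetric] norm_trace_char)
    finally show ?thesis
      using True by (simp add: op_mult_def op_adj_def op_id_def)
  next
    case False
    then show ?thesis by (auto simp: op_mult_def op_id_def)
  qed
qed

lemma quantum_channel_Gamma:
  assumes "prime p" "CARD('f::{field,finite}) = p ^ m" "finite A" "s \<in> A"
  shows "quantum_channel (basis A) (basis A) (Gamma A s :: (label \<Rightarrow> 'f) op \<Rightarrow> _)"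
proof -
  define K :: "'f \<times> 'f \<Rightarrow> (label \<Rightarrow> 'f) op" where
    "K = (\<lambda>(a, b). op_scale (1 / of_nat CARD('f)) (XZ_at p m A s a b))"
  \<comment> \<open>\<open>Gamma_eq_sum_XZ_at\<close> covers every matrix, so the two maps agree as
    functions and \<open>Gamma\<close> serves as its own linear extension.\<close>
  have "Gamma A s = kraus_map (basis A) UNIV K"
    by (simp add: fun_eq_iff[of "Gamma A s"] Gamma_eq_sum_XZ_at[OF assms] kraus_map_def K_def split_def
        op_mult_op_scale op_adj_op_scale op_scale_op_scale op_sum_op_scale power2_eq_square)
  moreover have "op_sum (\<lambda>\<nu>. op_mult (basis A) (op_adj (K \<nu>)) (K \<nu>)) UNIV = op_id (basis A)"
  proof -
    have "op_mult (basis A) (op_adj (K \<nu>)) (K \<nu>) =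
        op_scale (1 / of_nat CARD('f) ^ 2) (op_id (basis A))" for \<nu>
      by (simp add: K_def split_def op_mult_op_scale op_adj_op_scale op_scale_op_scale
          XZ_at_unitary[OF assms(3,4)] power2_eq_square)
    \<comment> \<open>There are q^2 pairs of field elements, matching the weight of each
      term.\<close>
    then show ?thesis
      by (simp add: fun_eq_iff op_sum_def op_scale_def op_id_def power2_eq_square)
  qed
  ultimately show ?thesis
    using assms(3) by (simp add: quantum_channel_kraus_map finite_basis)
qed

theorem lemma5:
  fixes p m q n c :: nat and A :: "label set" and H :: "(label \<Rightarrow> 'f::{field,finite}) set"
  assumes "prime p" and "q = p ^ m" and "CARD('f) = q" and "n \<ge> 1"
    and "A = register n c" and "H = basis A"
  shows "\<forall>i\<in>{1..n}.
    (\<forall>\<rho>\<in>density H.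
       Gamma A (Q i) \<rho> =
       op_scale (1 / of_nat q ^ 2)
         (op_sum (\<lambda>(a, b).
            op_mult H (op_mult H (XZ_at p m A (Q i) a b) \<rho>) (op_adj (XZ_at p m A (Q i) a b)))
          UNIV)) \<and>
    quantum_channel H H (Gamma A (Q i))"
proof
  fix i assume "i \<in> {1..n}"
  then have "finite A" "Q i \<in> A"
    using assms(5) by (auto simp: register_def)
  moreover have card: "CARD('f) = p ^ m"
    using assms by simp
  ultimately show "(\<forall>\<rho>\<in>density H.
       Gamma A (Q i) \<rho> =
       op_scale (1 / of_nat q ^ 2)
         (op_sum (\<lambda>(a, b).
            op_mult H (op_mult H (XZ_at p m A (Q i) a b) \<rho>) (op_adj (XZ_at p m A (Q i) a b)))
          UNIV)) \<and>
    quantum_channel H H (Gamma A (Q i))"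
    unfolding \<open>H = basis A\<close> \<open>CARD('f) = q\<close>[symmetric]
    by (intro conjI ballI Gamma_eq_sum_XZ_at[OF assms(1) card]
        quantum_channel_Gamma[OF assms(1) card])
qed

end
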